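(* Let $0<a<b$ and $0<c<d$ be real numbers, let $\Delta=[a,b]\times[c,d]\subseteq(0,\infty)\times(0,\infty)$, and let $f:\Delta\to\mathbb{R}$ be a partial differentiable mapping on $\Delta$. Let $q>1$ and let $p$ be given by $\frac1p+\frac1q=1$. If $\frac{\partial^{2}f}{\partial t\partial s}\in L(\Delta)$ and $\left|\frac{\partial^{2}f}{\partial t\partial s}\right|^{q}$ is harmonically convex on the co-ordinates on $\Delta$, then $$ \begin{aligned} &\Bigg|\frac{f(a,c)+f(a,d)+f(b,c)+f(b,d)}{4}+\frac{abcd}{(b-a)(d-c)}\int_{a}^{b}\int_{c}^{d}\frac{f(x,y)}{(xy)^{2}}\,dy\,dx\\ &\quad-\frac{1}{2}\Bigg[\frac{ab}{b-a}\int_{a}^{b}\frac{f(x,c)}{x^{2}}\,dx+\frac{ab}{b-a}\int_{a}^{b}\frac{f(x,d)}{x^{2}}\,dx+\frac{cd}{d-c}\int_{c}^{d}\frac{f(a,y)}{y^{2}}\,dy+\frac{cd}{d-c}\int_{c}^{d}\frac{f(b,y)}{y^{2}}\,dy\Bigg]\Bigg|\\ &\leq \frac{ac(b-a)(d-c)}{4bd\,(p+1)^{2/p}}\left(\frac{C_{1}\left|\frac{\partial^{2}f}{\partial t\partial s}(a,c)\right|^{q}+C_{2}\left|\frac{\partial^{2}f}{\partial t\partial s}(a,d)\right|^{q}+C_{3}\left|\frac{\partial^{2}f}{\partial t\partial s}(b,c)\right|^{q}+C_{4}\left|\frac{\partial^{2}f}{\partial t\partial s}(b,d)\right|^{q}}{4}\right)^{1/q},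 \end{aligned} $$ where $$ \begin{aligned} C_{1}&={}_{2}F_{1}\left(2q,1;2;1-\tfrac{a}{b}\right)\cdot{}_{2}F_{1}\left(2q,1;2;1-\tfrac{c}{d}\right),\\ C_{2}&={}_{2}F_{1}\left(2q,1;2;1-\tfrac{a}{b}\right)\cdot{}_{2}F_{1}\left(2q,2;3;1-\tfrac{c}{d}\right),\\ C_{3}&={}_{2}F_{1}\left(2q,2;3;1-\tfrac{a}{b}\right)\cdot{}_{2}F_{1}\left(2q,1;2;1-\tfrac{c}{d}\right),\\ C_{4}&={}_{2}F_{1}\left(2q,2;3;1-\tfrac{a}{b}\right)\cdot{}_{2}F_{1}\left(2q,2;3;1-\tfrac{c}{d}\right). \end{aligned} $$
   Context: A function $g:I\to\mathbb{R}$ on a real interval $I\subset\mathbb{R}\setminus\{0\}$ is harmonically convex if $g\left(\frac{xy}{tx+(1-t)y}\right)\leq t\,g(y)+(1-t)\,g(x)$ for all $x,y\in I$ and $t\in[0,1]$. A function $g:\Delta\to\mathbb{R}$ on $\Delta=[a,b]\times[c,d]\subseteq(0,\infty)\times(0,\infty)$ is harmonically convex on the co-ordinates on $\Delta$ if for every $y\in[c,d]$ the mapping $u\mapsto g(u,y)$ is harmonically convex on $[a,b]$ and for every $x\in[a,b]$ the mapping $v\mapsto g(x,v)$ is harmonically convex on $[c,d]$. $\frac{\partial^{2}f}{\partial t\partial s}$ denotes the mixed second-order partial derivative of $f$ with respect to its first variable ($t$) and its second variable ($s$), i.e. the $t$-derivative of $\frac{\partial f}{\partial s}$; "partial differentiable"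 means that the partial derivatives involved, including this one, exist on $\Delta$. $L(\Delta)$ is the space of Lebesgue integrable functions on $\Delta$. The Euler Beta function is $\beta(x,y)=\frac{\Gamma(x)\Gamma(y)}{\Gamma(x+y)}=\int_0^1 t^{x-1}(1-t)^{y-1}\,dt$ for $x,y>0$, and the hypergeometric function is, for real parameters $\alpha,\mu,\nu$ with $\nu>\mu>0$ and $|z|<1$, $${}_{2}F_{1}(\alpha,\mu;\nu;z)=\frac{1}{\beta(\mu,\nu-\mu)}\int_{0}^{1}t^{\mu-1}(1-t)^{\nu-\mu-1}(1-zt)^{-\alpha}\,dt .$$ *)

theory Defs
  imports "HOL-Analysis.Analysis"
begin

definition harmonically_convex_on :: "real set \<Rightarrow> (real \<Rightarrow> real) \<Rightarrow> bool" where
  "harmonically_convex_on I g \<longleftrightarrow> is_interval I \<and> 0 \<notin> I \<and>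
     (\<forall>x\<in>I. \<forall>y\<in>I. \<forall>t\<in>{0..1}. g (x * y / (t * x + (1 - t) * y)) \<le> t * g y + (1 - t) * g x)"

definition harmonically_convex_on_coordinates ::
    "real set \<Rightarrow> real set \<Rightarrow> (real \<Rightarrow> real \<Rightarrow> real) \<Rightarrow> bool" where
  "harmonically_convex_on_coordinates S T g \<longleftrightarrow>
     (\<forall>y\<in>T. harmonically_convex_on S (\<lambda>u. g u y)) \<and>
     (\<forall>x\<in>S. harmonically_convex_on T (\<lambda>v. g x v))"

text \<open>
  A function on the rectangle \<open>S \<times> T\<close> is represented by a total curried function.
  All derivatives are taken within \<open>S\<close> or \<open>T\<close> (so they are one-sided at the endpoints of
  compact intervals); hence, on \<open>S \<times> T\<close>, they depend only on the values of the function
  on \<open>S \<times> T\<close>.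
\<close>

definition partial_fst :: "real set \<Rightarrow> (real \<Rightarrow> real \<Rightarrow> real) \<Rightarrow> real \<Rightarrow> real \<Rightarrow> real" where
  "partial_fst S f x y = vector_derivative (\<lambda>u. f u y) (at x within S)"

definition partial_snd :: "real set \<Rightarrow> (real \<Rightarrow> real \<Rightarrow> real) \<Rightarrow> real \<Rightarrow> real \<Rightarrow> real" where
  "partial_snd T f x y = vector_derivative (\<lambda>v. f x v) (at y within T)"

definition mixed_partial ::
    "real set \<Rightarrow> real set \<Rightarrow> (real \<Rightarrow> real \<Rightarrow> real) \<Rightarrow> real \<Rightarrow> real \<Rightarrow> real" where
  "mixed_partial S T f = partial_fst S (partial_snd T f)"

definition partially_differentiable_on ::
    "real set \<Rightarrow> real set \<Rightarrow> (real \<Rightarrow> real \<Rightarrow> real) \<Rightarrow> bool" where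
  "partially_differentiable_on S T f \<longleftrightarrow>
     (\<forall>x\<in>S. \<forall>y\<in>T.
        (\<lambda>u. f u y) differentiable (at x within S) \<and>
        (\<lambda>v. f x v) differentiable (at y within T) \<and>
        (\<lambda>u. partial_snd T f u y) differentiable (at x within S))"

text \<open>
  Euler's integral representation, meaningful for \<open>\<nu> > \<mu> > 0\<close> and \<open>\<bar>z\<bar> < 1\<close>.
  The convention \<open>0 powr 0 = 0\<close> affects the integrand only at the endpoints.
\<close>

definition hypergeometric_2F1 :: "real \<Rightarrow> real \<Rightarrow> real \<Rightarrow> real \<Rightarrow> real" where
  "hypergeometric_2F1 \<alpha> \<mu> \<nu> z =
     1 / Beta \<mu> (\<nu> - \<mu>) *
     integral {0..1} (\<lambda>t. t powr (\<mu> - 1) * (1 - t) powr (\<nu> - \<mu> - 1) * (1 - z * t) powr (- \<alpha>))"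

end

theory Submission
  imports Defs
begin

text \<open>
  Harmonic convexity on \<open>[a, b]\<close> is ordinary convexity in the coordinate
  \<open>u = b (x - a) / ((b - a) x)\<close>, which maps \<open>[a, b]\<close> onto \<open>[0, 1]\<close> with density
  \<open>a b / ((b - a) x\<^sup>2)\<close>. Integrating by parts against \<open>2 u - 1\<close> in each variable turns the
  left-hand side into a quarter of the iterated integral of \<open>(2 u - 1) (2 v - 1) D\<close>, where
  \<open>D\<close> is the mixed derivative; \<open>\<bar>D\<bar>\<close> is bounded in terms of its
  corner values, so dominated convergence justifies differentiating the inner integral
  in \<open>x\<close>. Hoelder's inequality is applied in the form of a pointwise, suitably scaled Young inequality,
  after which \<open>\<bar>D\<bar> powr q\<close> is replaced by its bilinear majorant in \<open>(u, v)\<close>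
  and all integrals become one-dimensional.
  The majorant yields the weight \<open>2F1(2q, 1; 3)\<close> where the theorem has the larger \<open>2F1(2q, 1; 2)\<close>.
\<close>

section \<open>The harmonic coordinate and the chord bound\<close>

definition harmonic_coord :: "real \<Rightarrow> real \<Rightarrow> real \<Rightarrow> real" where
  "harmonic_coord a b x = b * (x - a) / ((b - a) * x)"

lemma harmonic_coord_endpoints [simp]:
  "harmonic_coord a b a = 0" "0 < b \<Longrightarrow> a < b \<Longrightarrow> harmonic_coord a b b = 1"
  by (simp_all add: harmonic_coord_def)

lemma harmonic_coord_mem:
  assumes "0 < a" "a < b" "x \<in> {a..b}"
  shows "harmonic_coord a b x \<in> {0..1}"
proof -
  have "b * (x - a) \<le> (b - a) * x"
    using mult_left_mono[of x b a] assms by (simp add: algebra_simps)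
  then show ?thesis
    using assms by (auto simp: harmonic_coord_def divide_le_eq_1)
qed

text \<open>In this form the inverse shows where the argument \<open>1 - a / b\<close> of the
  hypergeometric function comes from: powers of \<open>x\<close> become powers of
  \<open>1 - z * t\<close> with \<open>z = 1 - a / b\<close>.\<close>

lemma harmonic_coord_inverse:
  assumes "0 < a" "a < b" "a \<le> x"
  shows "a / (1 - (1 - a / b) * harmonic_coord a b x) = x"
proof -
  have "1 - (1 - a / b) * harmonic_coord a b x = a / x"
    using assms by (simp add: harmonic_coord_def divide_simps)
  then show ?thesis using assms by simp
qed

lemma has_real_derivative_harmonic_coord:
  assumes "a < b" "0 < x"
  shows "(harmonic_coord a b has_real_derivative a * b / ((b - a) * x\<^sup>2)) (at x within S)"
proof -
  have "b * ((b - a) * x) - b * (x - a) * (b - a) = (b - a) * (a * b)"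
    by (simp add: algebra_simps)
  then have "(b * ((b - a) * x) - b * (x - a) * (b - a)) / ((b - a) * x * ((b - a) * x))
      = a * b / ((b - a) * x\<^sup>2)"
    using assms by (simp add: power2_eq_square)
  moreover have "((\<lambda>x. b * (x - a) / ((b - a) * x)) has_real_derivative
      (b * ((b - a) * x) - b * (x - a) * (b - a)) / ((b - a) * x * ((b - a) * x))) (at x within S)"
    using assms by (intro DERIV_divide) (auto intro!: derivative_eq_intros)
  ultimately show ?thesis
    by (simp add: harmonic_coord_def[abs_def])
qed

text \<open>The coordinate is affine in \<open>1 / x\<close>, so
  \<open>t = 1 - harmonic_coord a b x\<close> solves \<open>1 / x = t / a + (1 - t) / b\<close>. The
  defining inequality is then used at the points \<open>b\<close> and \<open>a\<close>, in this
  order.\<close>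

lemma harmonically_convex_on_le:
  assumes "0 < a" "a < b" "harmonically_convex_on {a..b} g" "x \<in> {a..b}"
  shows "g x \<le> (1 - harmonic_coord a b x) * g a + harmonic_coord a b x * g b"
proof -
  define t where "t = 1 - harmonic_coord a b x"
  have t: "t \<in> {0..1}"
    using harmonic_coord_mem[OF assms(1,2,4)] by (auto simp: t_def)
  have "t * b + (1 - t) * a = a * b / x"
    using assms by (simp add: t_def harmonic_coord_def divide_simps) (simp add: algebra_simps)
  then have "b * a / (t * b + (1 - t) * a) = x"
    using assms by simp
  moreover have "g (b * a / (t * b + (1 - t) * a)) \<le> t * g a + (1 - t) * g b"
    using assms t unfolding harmonically_convex_on_def by auto
  ultimately show ?thesis by (simp add: t_def)
qed

section \<open>Integration by parts and differentiation under the integral\<close>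

text \<open>Apply the product rule to \<open>(2 * u - 1) * h\<close>, whose kernel is -1 at
  \<open>a\<close> and 1 at \<open>b\<close>. The gauge integral recovers a function from any
  everywhere-existing derivative, so integrability of the term with \<open>h'\<close> is part of the
  result.\<close>

lemma harmonic_trapezoid_has_integral:
  fixes h h' :: "real \<Rightarrow> real"
  assumes "0 < a" "a < b"
    and h: "\<And>x. x \<in> {a..b} \<Longrightarrow> (h has_real_derivative h' x) (at x within {a..b})"
  shows "((\<lambda>x. (2 * harmonic_coord a b x - 1) * h' x) has_integral
      h a + h b - 2 * (a * b / (b - a) * integral {a..b} (\<lambda>x. h x / x\<^sup>2))) {a..b}"
proof -
  let ?k = "\<lambda>x. 2 * harmonic_coord a b x - 1"
  let ?r = "\<lambda>x. a * b / ((b - a) * x\<^sup>2)"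
  have "((\<lambda>x. 2 * ?r x * h x + ?k x * h' x) has_integral ?k b * h b - ?k a * h a) {a..b}"
  proof (rule fundamental_theorem_of_calculus)
    fix x assume x: "x \<in> {a..b}"
    have "((\<lambda>x. ?k x * h x) has_real_derivative 2 * ?r x * h x + ?k x * h' x) (at x within {a..b})"
      using x assms by (auto intro!: derivative_eq_intros has_real_derivative_harmonic_coord h)
    then show "((\<lambda>x. ?k x * h x) has_vector_derivative 2 * ?r x * h x + ?k x * h' x)
        (at x within {a..b})"
      by (simp add: has_real_derivative_iff_has_vector_derivative)
  qed (use assms in simp)
  moreover have "continuous_on {a..b} (\<lambda>x. h x / x\<^sup>2)"
    using assms(1) by (intro continuous_intros DERIV_continuous_on[OF h]) auto
  then have "((\<lambda>x. 2 * (a * b / (b - a)) * (h x / x\<^sup>2)) has_integral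
      2 * (a * b / (b - a)) * integral {a..b} (\<lambda>x. h x / x\<^sup>2)) {a..b}"
    by (intro has_integral_mult_right integrable_integral integrable_continuous_real)
  ultimately have "((\<lambda>x. 2 * ?r x * h x + ?k x * h' x - 2 * (a * b / (b - a)) * (h x / x\<^sup>2)) has_integral
      (?k b * h b - ?k a * h a) - 2 * (a * b / (b - a)) * integral {a..b} (\<lambda>x. h x / x\<^sup>2)) {a..b}"
    by (rule has_integral_diff)
  then show ?thesis
    using assms by (simp add: algebra_simps)
qed

text \<open>The mean value inequality bounds every difference quotient in \<open>x\<close> by
  \<open>M\<close>, so dominated convergence applies along each sequence tending to
  \<open>x0\<close>. It also delivers integrability of the limit \<open>G' x0\<close>.\<close>

lemma has_real_derivative_integral_bounded:
  fixes G :: "real \<Rightarrow> real \<Rightarrow> real"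
  assumes "a < b" and x0: "x0 \<in> {a..b}"
    and int: "\<And>x. x \<in> {a..b} \<Longrightarrow> G x integrable_on {c..d}"
    and der: "\<And>x y. x \<in> {a..b} \<Longrightarrow> y \<in> {c..d} \<Longrightarrow>
      ((\<lambda>x. G x y) has_real_derivative G' x y) (at x within {a..b})"
    and bound: "\<And>x y. x \<in> {a..b} \<Longrightarrow> y \<in> {c..d} \<Longrightarrow> \<bar>G' x y\<bar> \<le> M"
  shows "G' x0 integrable_on {c..d}"
    and "((\<lambda>x. integral {c..d} (G x)) has_real_derivative integral {c..d} (G' x0))
      (at x0 within {a..b})"
proof -
  let ?Q = "\<lambda>x y. (G x y - G x0 y) / (x - x0)"
  have lim: "G' x0 integrable_on {c..d} \<and>
      (\<lambda>n. integral {c..d} (?Q (X n))) \<longlonglongrightarrow> integral {c..d} (G' x0)"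
    if X: "\<And>n. X n \<in> {a..b} - {x0}" "X \<longlonglongrightarrow> x0" for X :: "nat \<Rightarrow> real"
  proof -
    have "?Q (X n) integrable_on {c..d}" for n
      using X(1)[of n] x0 by (intro integrable_on_divide integrable_diff int) auto
    moreover have "(\<lambda>_. M) integrable_on {c..d}"
      by (rule integrable_const_ivl)
    moreover have "norm (?Q (X n) y) \<le> M" if y: "y \<in> {c..d}" for n y
    proof -
      have "norm (G (X n) y - G x0 y) \<le> M * norm (X n - x0)"
        using X(1)[of n] x0 y
        by (intro field_differentiable_bound[of "{a..b}" "\<lambda>x. G x y" "\<lambda>x. G' x y"])
          (auto intro: der bound[simplified])
      then show ?thesis
        using X(1)[of n] by (simp add: divide_le_eq)
    qed
    moreover have "(\<lambda>n. ?Q (X n) y) \<longlonglongrightarrow> G' x0 y" if y: "y \<in> {c..d}" for y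
      using der[OF x0 y] X
      unfolding has_field_derivative_iff tendsto_at_iff_sequentially comp_def by simp
    ultimately show ?thesis
      by (intro conjI dominated_convergence[of "\<lambda>n. ?Q (X n)" "{c..d}" "\<lambda>_. M" "G' x0"])
  qed
  \<comment> \<open>Integrability of \<open>G' x0\<close> requires one actual sequence; it exists
    because a point of a nondegenerate interval is a limit point of it.\<close>
  have "x0 islimpt {a..b}"
    using assms(1) x0 by simp
  then obtain X where "\<And>n. X n \<in> {a..b} - {x0}" "X \<longlonglongrightarrow> x0"
    unfolding islimpt_sequential by blast
  from lim[OF this] show "G' x0 integrable_on {c..d}" ..
  show "((\<lambda>x. integral {c..d} (G x)) has_real_derivative integral {c..d} (G' x0))
      (at x0 within {a..b})"
    unfolding has_field_derivative_iff tendsto_at_iff_sequentially comp_def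
  proof (intro allI impI)
    fix X :: "nat \<Rightarrow> real"
    assume X: "\<forall>i. X i \<in> {a..b} - {x0}" "X \<longlonglongrightarrow> x0"
    have "integral {c..d} (?Q (X n))
        = (integral {c..d} (G (X n)) - integral {c..d} (G x0)) / (X n - x0)" for n
      using X(1) x0 
      by (simp add: Henstock_Kurzweil_Integration.integral_diff int)
    then show "(\<lambda>n. (integral {c..d} (G (X n)) - integral {c..d} (G x0)) / (X n - x0))
        \<longlonglongrightarrow> integral {c..d} (G' x0)"
      using conjunct2[OF lim[OF X(1)[rule_format] X(2)]] by (simp only:)
  qed
qed

section \<open>Substitution and the one-dimensional weight integrals\<close>

lemma harmonic_substitution_has_integral:
  fixes g :: "real \<Rightarrow> real"
  assumes "0 < a" "a < b" "continuous_on {0..1} g"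
  shows "((\<lambda>x. a * b / ((b - a) * x\<^sup>2) * g (harmonic_coord a b x)) has_integral
    integral {0..1} g) {a..b}"
proof -
  have "harmonic_coord a b ` {a..b} \<subseteq> {0..1}"
    using harmonic_coord_mem[OF assms(1,2)] by blast
  then show ?thesis
    using has_integral_substitution[of a b "harmonic_coord a b" 0 1 g "\<lambda>x. a * b / ((b - a) * x\<^sup>2)"]
      assms has_real_derivative_harmonic_coord[of a b]
    by simp
qed

text \<open>Splitting at 1/2 removes the absolute value, and each half contributes
  \<open>1 / (2 * (p + 1))\<close>. The fundamental theorem is taken in its interior form, so no
  derivative is computed at 1/2, where the base of the power vanishes.\<close>

lemma integral_abs_centered_powr:
  fixes p :: real
  assumes "p > 0"
  shows "integral {0..1} (\<lambda>u. \<bar>2 * u - 1\<bar> powr p) = 1 / (p + 1)"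
proof -
  have left: "((\<lambda>u. \<bar>2 * u - 1\<bar> powr p) has_integral
      - ((1 - 2 * (1 / 2)) powr (p + 1) / (2 * (p + 1))) -
      - ((1 - 2 * 0) powr (p + 1) / (2 * (p + 1)))) {0..1 / 2}"
  proof (rule fundamental_theorem_of_calculus_interior)
    show "((\<lambda>u. - ((1 - 2 * u) powr (p + 1) / (2 * (p + 1)))) has_vector_derivative
        \<bar>2 * u - 1\<bar> powr p) (at u)" if "u \<in> {0<..<1 / 2}" for u
      unfolding has_real_derivative_iff_has_vector_derivative[symmetric]
      using that assms by (auto intro!: derivative_eq_intros simp: divide_simps)
  qed (use assms in \<open>auto intro!: continuous_on_powr' continuous_on_minus continuous_on_divide
      continuous_on_diff continuous_on_mult continuous_on_const continuous_on_id\<close>)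
  have right: "((\<lambda>u. \<bar>2 * u - 1\<bar> powr p) has_integral
      ((2 * 1 - 1) powr (p + 1) / (2 * (p + 1))) -
      ((2 * (1 / 2) - 1) powr (p + 1) / (2 * (p + 1)))) {1 / 2..1}"
  proof (rule fundamental_theorem_of_calculus_interior)
    show "((\<lambda>u. (2 * u - 1) powr (p + 1) / (2 * (p + 1))) has_vector_derivative
        \<bar>2 * u - 1\<bar> powr p) (at u)" if "u \<in> {1 / 2<..<1}" for u
      unfolding has_real_derivative_iff_has_vector_derivative[symmetric]
      using that assms by (auto intro!: derivative_eq_intros simp: divide_simps)
  qed (use assms in \<open>auto intro!: continuous_on_powr' continuous_on_minus continuous_on_divide
      continuous_on_diff continuous_on_mult continuous_on_const continuous_on_id\<close>)
  show ?thesis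
    using integral_unique[OF has_integral_combine[OF _ _ left right]] assms
    by (simp add: field_simps)
qed

text \<open>Both outer exponents are 0. Since \<open>0 powr 0 = 0\<close>, those factors equal 1
  only inside the interval, so the two endpoints are discarded as a null set.\<close>

lemma hypergeometric_2F1_one_two:
  "hypergeometric_2F1 \<alpha> 1 2 z = integral {0..1} (\<lambda>t. (1 - z * t) powr - \<alpha>)"
proof -
  have "integral {0..1} (\<lambda>t. t powr (1 - 1) * (1 - t) powr (2 - 1 - 1) * (1 - z * t) powr - \<alpha>)
      = integral {0..1} (\<lambda>t. (1 - z * t) powr - \<alpha>)"
    by (rule integral_spike[of "{0, 1}"]) auto
  moreover have "Beta 1 1 = (1 :: real)"
    using Gamma_fact[of 1, where 'a = real] by (simp add: Beta_def numeral_2_eq_2)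
  ultimately show ?thesis
    by (simp add: hypergeometric_2F1_def)
qed

lemma hypergeometric_2F1_two_three:
  "hypergeometric_2F1 \<alpha> 2 3 z = 2 * integral {0..1} (\<lambda>t. t * (1 - z * t) powr - \<alpha>)"
proof -
  have "integral {0..1} (\<lambda>t. t powr (2 - 1) * (1 - t) powr (3 - 2 - 1) * (1 - z * t) powr - \<alpha>)
      = integral {0..1} (\<lambda>t. t * (1 - z * t) powr - \<alpha>)"
    by (rule integral_spike[of "{0, 1}"]) auto
  moreover have "Beta 2 (3 - 2) = (1 / 2 :: real)"
    using Gamma_fact[of 1, where 'a = real] Gamma_fact[of 2, where 'a = real]
    by (simp add: Beta_def)
  ultimately show ?thesis
    unfolding hypergeometric_2F1_def by (simp only:) simp
qed

lemma continuous_on_powr_unit: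
  fixes z :: real
  assumes "z < 1"
  shows "continuous_on {0..1} (\<lambda>t. (1 - z * t) powr \<alpha>)"
proof -
  have "z * t < 1" if "t \<in> {0..1}" for t
  proof (cases "z \<le> 0")
    case True
    then have "z * t \<le> 0"
      using that by (simp add: mult_nonpos_nonneg)
    then show ?thesis by simp
  next
    case False
    then have "z * t \<le> z"
      using that by (intro mult_left_le) auto
    then show ?thesis
      using assms by linarith
  qed
  then show ?thesis
    by (intro continuous_intros) force
qed

text \<open>Chebyshev's argument: \<open>1 - 2 * t\<close> and the increasing weight \<open>(1 - z * t) powr - \<alpha>\<close>
  are oppositely ordered around \<open>t = 1 / 2\<close>.\<close>

lemma integral_complement_weight_le:
  assumes "0 \<le> z" "z < 1" "0 \<le> \<alpha>"
  shows "2 * integral {0..1} (\<lambda>t. (1 - t) * (1 - z * t) powr - \<alpha>) \<le> hypergeometric_2F1 \<alpha> 1 2 z"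
proof -
  let ?m = "\<lambda>t. (1 - z * t) powr - \<alpha>"
  note cont = continuous_on_powr_unit[OF assms(2), of "- \<alpha>"]
  have i0: "((\<lambda>t. ?m t) has_integral integral {0..1} ?m) {0..1}"
    by (intro integrable_integral integrable_continuous_real cont)
  have i1: "((\<lambda>t. (1 - t) * ?m t) has_integral integral {0..1} (\<lambda>t. (1 - t) * ?m t)) {0..1}"
    by (intro integrable_integral integrable_continuous_real continuous_intros cont)
  have i2: "((\<lambda>t. 1 - 2 * t) has_integral 1 - 1\<^sup>2 - (0 - 0\<^sup>2)) {0..1::real}"
    by (rule fundamental_theorem_of_calculus)
      (auto intro!: derivative_eq_intros simp: has_real_derivative_iff_has_vector_derivative[symmetric])
  \<comment> \<open>The right-hand side is 0, left in the unevaluated form of \<open>i2\<close>. On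
    the left, \<open>2 * (1 - t) - 1 = 1 - 2 * t\<close>. Comparing with the constant
    \<open>?m (1 / 2)\<close> makes both factors of \<open>(1 - 2 * t) * (?m t - ?m (1 / 2))\<close>
    switch sign at 1/2.\<close>
  have "2 * integral {0..1} (\<lambda>t. (1 - t) * ?m t) - integral {0..1} ?m \<le> ?m (1 / 2) * (1 - 1\<^sup>2 - (0 - 0\<^sup>2))"
  proof (rule has_integral_le[OF has_integral_diff[OF has_integral_mult_right[OF i1] i0]
        has_integral_mult_right[OF i2]])
    fix t :: real assume t: "t \<in> {0..1}"
    have le1: "z * s < 1" if "s \<in> {0..1}" for s
    proof -
      have "z * s \<le> z"
        using that assms by (intro mult_left_le) auto
      then show ?thesis
        using assms by linarith
    qed
    have "(1 - 2 * t) * (?m t - ?m (1 / 2)) \<le> 0"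
    proof (cases "t \<le> 1 / 2")
      case True
      then have "z * t \<le> z * (1 / 2)"
        using assms by (intro mult_left_mono)
      then have "?m t \<le> ?m (1 / 2)"
        using assms le1[of "1 / 2"] by (intro powr_mono2') auto
      then show ?thesis
        using True by (simp add: mult_nonneg_nonpos)
    next
      case False
      then have "z * (1 / 2) \<le> z * t"
        using assms by (intro mult_left_mono) auto
      then have "?m (1 / 2) \<le> ?m t"
        using assms t le1[of t] by (intro powr_mono2') auto
      then show ?thesis
        using False by (simp add: mult_nonpos_nonneg)
    qed
    then show "2 * ((1 - t) * ?m t) - ?m t \<le> ?m (1 / 2) * (1 - 2 * t)"
      by (simp add: algebra_simps)
  qed
  then show ?thesis
    by (simp add: hypergeometric_2F1_one_two)
qed

lemma powr_eq_harmonic_coord: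
  assumes "0 < a" "a < b" "x \<in> {a..b}"
  shows "x powr \<alpha> = a powr \<alpha> * (1 - (1 - a / b) * harmonic_coord a b x) powr - \<alpha>"
proof -
  let ?w = "1 - (1 - a / b) * harmonic_coord a b x"
  have x: "a / ?w = x"
    using assms by (intro harmonic_coord_inverse) auto
  then have "0 < ?w"
    using assms zero_less_divide_iff[of a ?w] by simp
  have "x powr \<alpha> = (a / ?w) powr \<alpha>"
    by (simp only: x)
  also have "\<dots> = a powr \<alpha> * ?w powr - \<alpha>"
    using assms(1) \<open>0 < ?w\<close> by (subst powr_divide) (auto simp: powr_minus_divide)
  finally show ?thesis .
qed

text \<open>Under the substitution \<open>t = harmonic_coord a b x\<close>, the factor
  \<open>x powr \<alpha>\<close> turns into the Euler kernel. For \<alpha> = 2q these are the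
  integrals behind C1 to C4.\<close>

lemma harmonic_weight_has_integral:
  fixes g :: "real \<Rightarrow> real"
  assumes "0 < a" "a < b" "continuous_on {0..1} g"
  shows "((\<lambda>x. a * b / ((b - a) * x\<^sup>2) * x powr \<alpha> * g (harmonic_coord a b x)) has_integral
    a powr \<alpha> * integral {0..1} (\<lambda>t. g t * (1 - (1 - a / b) * t) powr - \<alpha>)) {a..b}"
proof -
  let ?m = "\<lambda>t. (1 - (1 - a / b) * t) powr - \<alpha>"
  have "continuous_on {0..1} (\<lambda>t. g t * ?m t)"
    using assms by (intro continuous_intros continuous_on_powr_unit) auto
  then have "((\<lambda>x. a powr \<alpha> * (a * b / ((b - a) * x\<^sup>2) *
        (g (harmonic_coord a b x) * ?m (harmonic_coord a b x)))) has_integral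
      a powr \<alpha> * integral {0..1} (\<lambda>t. g t * ?m t)) {a..b}"
    using assms by (intro has_integral_mult_right harmonic_substitution_has_integral)
  then show ?thesis
  proof (rule has_integral_eq[rotated])
    fix x assume "x \<in> {a..b}"
    note x = powr_eq_harmonic_coord[OF assms(1,2) this, of \<alpha>]
    show "a powr \<alpha> * (a * b / ((b - a) * x\<^sup>2) *
          (g (harmonic_coord a b x) * ?m (harmonic_coord a b x)))
        = a * b / ((b - a) * x\<^sup>2) * x powr \<alpha> * g (harmonic_coord a b x)"
      unfolding x by (simp only: ac_simps)
  qed
qed

section \<open>Hoelder's inequality through Young, and the kernel estimate\<close>

text \<open>Young's inequality for \<open>X / P powr (1 / p)\<close> and
  \<open>Y / K powr (1 / q)\<close>. If \<open>P\<close> and \<open>K\<close> bound the integrals of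
  the two powers, the bracket integrates to at most \<open>1 / p + 1 / q = 1\<close>, which is
  Hoelder's bound.\<close>

lemma Youngs_inequality_scaled:
  fixes p q P K X Y :: real
  assumes "p > 1" "q > 1" "1 / p + 1 / q = 1" "0 < P" "0 < K" "0 \<le> X" "0 \<le> Y"
  shows "X * Y \<le> P powr (1 / p) * K powr (1 / q) * (X powr p / (p * P) + Y powr q / (q * K))"
proof -
  let ?s = "P powr (1 / p)" and ?t = "K powr (1 / q)"
  have "(X / ?s) * (Y / ?t) \<le> (X / ?s) powr p / p + (Y / ?t) powr q / q"
    using assms by (intro Youngs_inequality) auto
  also have "\<dots> = X powr p / (p * P) + Y powr q / (q * K)"
    using assms by (simp add: powr_divide powr_powr mult.commute)
  finally have "?s * ?t * ((X / ?s) * (Y / ?t)) \<le> ?s * ?t * (X powr p / (p * P) + Y powr q / (q * K))"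
    by (intro mult_left_mono) auto
  then show ?thesis
    using assms by simp
qed

text \<open>Comparison is made first in the inner and then in the outer variable, so a pointwise
  majorant with known iterated integrals suffices and Fubini's theorem does not enter.\<close>

lemma iterated_integral_bound:
  fixes G B :: "real \<Rightarrow> real \<Rightarrow> real"
  assumes G: "\<And>x. x \<in> S \<Longrightarrow> G x integrable_on T"
    and E: "((\<lambda>x. k x * integral T (G x)) has_integral E) S"
    and B: "\<And>x y. x \<in> S \<Longrightarrow> y \<in> T \<Longrightarrow> \<bar>k x * G x y\<bar> \<le> B x y"
    and J: "\<And>x. x \<in> S \<Longrightarrow> (B x has_integral J x) T"
    and N: "(J has_integral N) S"
  shows "\<bar>E\<bar> \<le> N"
proof -
  have "norm (integral T (\<lambda>y. k x * G x y)) \<le> integral T (B x)" if "x \<in> S" for x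
    using that by (intro Henstock_Kurzweil_Integration.integral_norm_bound_integral)
      (auto intro!: integrable_on_mult_right G B has_integral_integrable[OF J])
  then have "norm (integral S (\<lambda>x. k x * integral T (G x))) \<le> integral S J"
    by (intro Henstock_Kurzweil_Integration.integral_norm_bound_integral has_integral_integrable[OF E] has_integral_integrable[OF N])
      (simp add: integral_unique[OF J])
  then show ?thesis
    by (simp add: integral_unique[OF E] integral_unique[OF N])
qed

text \<open>Use the chord bound in \<open>x\<close> at fixed \<open>y\<close>, then the chord bound
  in \<open>y\<close> on the two edges \<open>x = a\<close> and \<open>x = b\<close>.\<close>

lemma harmonically_convex_on_coordinates_le:
  assumes "0 < a" "a < b" "0 < c" "c < d"
    and "harmonically_convex_on_coordinates {a..b} {c..d} g"
    and "x \<in> {a..b}" "y \<in> {c..d}"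
  defines "u \<equiv> harmonic_coord a b x" and "v \<equiv> harmonic_coord c d y"
  shows "g x y \<le> (1 - u) * ((1 - v) * g a c + v * g a d) + u * ((1 - v) * g b c + v * g b d)"
proof -
  have u: "u \<in> {0..1}"
    unfolding u_def using assms by (intro harmonic_coord_mem)
  have "g x' y \<le> (1 - v) * g x' c + v * g x' d" if "x' \<in> {a..b}" for x'
    using harmonically_convex_on_le[of c d "g x'" y] assms that
    by (simp add: harmonically_convex_on_coordinates_def)
  then have "(1 - u) * g a y + u * g b y
      \<le> (1 - u) * ((1 - v) * g a c + v * g a d) + u * ((1 - v) * g b c + v * g b d)"
    using u assms(2) by (intro add_mono mult_left_mono) auto
  moreover have "g x y \<le> (1 - u) * g a y + u * g b y"
    using harmonically_convex_on_le[of a b "\<lambda>x. g x y" x] assms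
    by (simp add: harmonically_convex_on_coordinates_def)
  ultimately show ?thesis by simp
qed

lemma harmonic_kernel_powr_has_integral:
  fixes p :: real
  assumes "0 < a" "a < b" "0 < p"
  shows "((\<lambda>x. a * b / ((b - a) * x\<^sup>2) * \<bar>2 * harmonic_coord a b x - 1\<bar> powr p)
    has_integral 1 / (p + 1)) {a..b}"
  unfolding integral_abs_centered_powr[OF assms(3), symmetric]
  using assms
  by (intro harmonic_substitution_has_integral[where g = "\<lambda>u. \<bar>2 * u - 1\<bar> powr p"])
    (auto intro!: continuous_on_powr' continuous_on_rabs continuous_on_diff continuous_on_mult
      continuous_on_const continuous_on_id)

lemma hypergeometric_2F1_two_three_nonneg:
  assumes "z < 1"
  shows "0 \<le> hypergeometric_2F1 \<alpha> 2 3 z"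
  unfolding hypergeometric_2F1_two_three
  by (intro mult_nonneg_nonneg Henstock_Kurzweil_Integration.integral_nonneg
      integrable_continuous_real continuous_intros continuous_on_powr_unit assms) auto

text \<open>The exact value is half of \<open>a powr \<alpha>\<close> times 2F1(\<alpha>, 1; 3).
  Hiding it behind \<open>R\<close> keeps just what the monotonicity argument uses: its sign and the
  Chebyshev bound by 2F1(\<alpha>, 1; 2).\<close>

lemma harmonic_weight_decreasing_has_integral:
  assumes "0 < a" "a < b" "0 \<le> \<alpha>"
  obtains R where "0 \<le> R" "R \<le> a powr \<alpha> * hypergeometric_2F1 \<alpha> 1 2 (1 - a / b) / 2"
    "((\<lambda>x. a * b / ((b - a) * x\<^sup>2) * x powr \<alpha> * (1 - harmonic_coord a b x)) has_integral R) {a..b}"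
proof
  let ?I = "integral {0..1} (\<lambda>t. (1 - t) * (1 - (1 - a / b) * t) powr - \<alpha>)"
  show "((\<lambda>x. a * b / ((b - a) * x\<^sup>2) * x powr \<alpha> * (1 - harmonic_coord a b x)) has_integral
      a powr \<alpha> * ?I) {a..b}"
    using assms by (intro harmonic_weight_has_integral continuous_intros)
  show "0 \<le> a powr \<alpha> * ?I"
    using assms by (intro mult_nonneg_nonneg Henstock_Kurzweil_Integration.integral_nonneg
        integrable_continuous_real continuous_intros continuous_on_powr_unit) auto
  have "2 * ?I \<le> hypergeometric_2F1 \<alpha> 1 2 (1 - a / b)"
    using assms by (intro integral_complement_weight_le) auto
  then have "a powr \<alpha> * ?I \<le> a powr \<alpha> * (hypergeometric_2F1 \<alpha> 1 2 (1 - a / b) / 2)"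
    by (intro mult_left_mono) auto
  then show "a powr \<alpha> * ?I \<le> a powr \<alpha> * hypergeometric_2F1 \<alpha> 1 2 (1 - a / b) / 2"
    by simp
qed

lemma harmonic_weight_increasing_has_integral:
  assumes "0 < a" "a < b"
  shows "((\<lambda>x. a * b / ((b - a) * x\<^sup>2) * x powr \<alpha> * harmonic_coord a b x) has_integral
    a powr \<alpha> * hypergeometric_2F1 \<alpha> 2 3 (1 - a / b) / 2) {a..b}"
  using harmonic_weight_has_integral[of a b "\<lambda>t. t" \<alpha>] assms
  by (simp add: hypergeometric_2F1_two_three)

text \<open>Hoelder's inequality with respect to the product density
  \<open>\<rho> x * \<sigma> y\<close>, pairing the kernel
  \<open>\<bar>k x\<bar> * \<bar>l y\<bar>\<close> in exponent \<open>p\<close> with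
  \<open>x\<^sup>2 * y\<^sup>2 * \<bar>D x y\<bar>\<close> in exponent \<open>q\<close>. The number
  \<open>K\<close> bounds the second power integral; it is kept positive because Young's inequality
  divides by it.\<close>

lemma harmonic_kernel_estimate:
  fixes D :: "real \<Rightarrow> real \<Rightarrow> real" and a b c d p q E K :: real
  defines "k \<equiv> \<lambda>x. 2 * harmonic_coord a b x - 1" and "l \<equiv> \<lambda>y. 2 * harmonic_coord c d y - 1"
    and "A1 \<equiv> hypergeometric_2F1 (2 * q) 1 2 (1 - a / b)"
    and "A2 \<equiv> hypergeometric_2F1 (2 * q) 2 3 (1 - a / b)"
    and "B1 \<equiv> hypergeometric_2F1 (2 * q) 1 2 (1 - c / d)"
    and "B2 \<equiv> hypergeometric_2F1 (2 * q) 2 3 (1 - c / d)"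
  assumes "0 < a" "a < b" "0 < c" "c < d" "q > 1" "1 / p + 1 / q = 1"
    and conv: "harmonically_convex_on_coordinates {a..b} {c..d} (\<lambda>x y. \<bar>D x y\<bar> powr q)"
    and int: "\<And>x. x \<in> {a..b} \<Longrightarrow> (\<lambda>y. l y * D x y) integrable_on {c..d}"
    and E: "((\<lambda>x. k x * integral {c..d} (\<lambda>y. l y * D x y)) has_integral E) {a..b}"
    and K: "0 < K" "a powr (2 * q) * c powr (2 * q) *
      ((A1 * B1 * \<bar>D a c\<bar> powr q + A1 * B2 * \<bar>D a d\<bar> powr q
        + A2 * B1 * \<bar>D b c\<bar> powr q + A2 * B2 * \<bar>D b d\<bar> powr q) / 4) \<le> K"
  shows "\<bar>E\<bar> \<le> (b - a) * (d - c) / (a * b * c * d) * (((1 / (p + 1))\<^sup>2) powr (1 / p) * K powr (1 / q))"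
proof -
  have "1 / q < 1" "0 < 1 / q"
    using \<open>q > 1\<close> by auto
  then have "1 / p < 1" "0 < 1 / p"
    using \<open>1 / p + 1 / q = 1\<close> by linarith+
  then have "p > 1" by (simp add: divide_less_eq_1)
  define \<rho> where "\<rho> = (\<lambda>x. a * b / ((b - a) * x\<^sup>2))"
  define \<sigma> where "\<sigma> = (\<lambda>y. c * d / ((d - c) * y\<^sup>2))"
  define r0 where "r0 = (\<lambda>x. \<rho> x * x powr (2 * q) * (1 - harmonic_coord a b x))"
  define r1 where "r1 = (\<lambda>x. \<rho> x * x powr (2 * q) * harmonic_coord a b x)"
  define s0 where "s0 = (\<lambda>y. \<sigma> y * y powr (2 * q) * (1 - harmonic_coord c d y))"
  define s1 where "s1 = (\<lambda>y. \<sigma> y * y powr (2 * q) * harmonic_coord c d y)"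
  \<comment> \<open>\<open>P\<close> is the product of the two kernel integrals \<open>k\<close> and
    \<open>l\<close> below. The constant \<kappa> is chosen so that \<open>\<kappa> * (\<rho> x *
    \<sigma> y) * (x\<^sup>2 * y\<^sup>2) = 1\<close>.\<close>
  define P where "P = (1 / (p + 1))\<^sup>2"
  define \<kappa> where "\<kappa> = (b - a) * (d - c) / (a * b * c * d)"
  define \<Gamma> where "\<Gamma> = \<kappa> * (P powr (1 / p) * K powr (1 / q))"
  define g where "g = (\<lambda>x y. \<bar>D x y\<bar> powr q)"
  have "0 < P" using \<open>p > 1\<close> by (simp add: P_def)
  have "0 < \<kappa>" using assms by (simp add: \<kappa>_def)
  then have "0 \<le> \<Gamma>" by (simp add: \<Gamma>_def)
  have k: "((\<lambda>x. \<rho> x * \<bar>k x\<bar> powr p) has_integral 1 / (p + 1)) {a..b}"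
    unfolding \<rho>_def k_def using assms \<open>p > 1\<close> by (intro harmonic_kernel_powr_has_integral) auto
  have l: "((\<lambda>y. \<sigma> y * \<bar>l y\<bar> powr p) has_integral 1 / (p + 1)) {c..d}"
    unfolding \<sigma>_def l_def using assms \<open>p > 1\<close> by (intro harmonic_kernel_powr_has_integral) auto
  obtain R0 where R0: "0 \<le> R0" "R0 \<le> a powr (2 * q) * A1 / 2" and r0: "(r0 has_integral R0) {a..b}"
    unfolding r0_def \<rho>_def A1_def
    using assms by (elim harmonic_weight_decreasing_has_integral[rotated 3]) auto
  obtain S0 where S0: "0 \<le> S0" "S0 \<le> c powr (2 * q) * B1 / 2" and s0: "(s0 has_integral S0) {c..d}"
    unfolding s0_def \<sigma>_def B1_def
    using assms by (elim harmonic_weight_decreasing_has_integral[rotated 3]) auto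
  define R1 where "R1 = a powr (2 * q) * A2 / 2"
  define S1 where "S1 = c powr (2 * q) * B2 / 2"
  have r1: "(r1 has_integral R1) {a..b}"
    unfolding r1_def \<rho>_def R1_def A2_def using assms by (intro harmonic_weight_increasing_has_integral)
  have s1: "(s1 has_integral S1) {c..d}"
    unfolding s1_def \<sigma>_def S1_def B2_def using assms by (intro harmonic_weight_increasing_has_integral)
  have nonneg: "0 \<le> R1" "0 \<le> S1"
    using assms by (simp_all add: R1_def S1_def A2_def B2_def hypergeometric_2F1_two_three_nonneg)
  have g_nonneg: "0 \<le> g x y" for x y by (simp add: g_def)
  \<comment> \<open>The weighted bilinear majorant of \<open>g\<close>. It is a sum of products of
    functions of one variable, so its iterated integral is the same expression \<open>V\<close> in
    the four weight integrals.\<close>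
  define W where "W = (\<lambda>x y. r0 x * (s0 y * g a c + s1 y * g a d) + r1 x * (s0 y * g b c + s1 y * g b d))"
  define V where "V = R0 * (S0 * g a c + S1 * g a d) + R1 * (S0 * g b c + S1 * g b d)"
  have "\<bar>E\<bar> \<le> \<Gamma> * (1 / (p + 1) * (1 / (p + 1)) / (p * P) + V / (q * K))"
  proof (rule iterated_integral_bound[OF int E])
    show "\<bar>k x * (l y * D x y)\<bar>
        \<le> \<Gamma> * ((\<rho> x * \<bar>k x\<bar> powr p) * (\<sigma> y * \<bar>l y\<bar> powr p) / (p * P) + W x y / (q * K))"
      if x: "x \<in> {a..b}" and y: "y \<in> {c..d}" for x y
    proof -
      define X where "X = \<bar>k x\<bar> * \<bar>l y\<bar>"
      \<comment> \<open>The squares undo the \<open>1 / x\<^sup>2\<close> and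
        \<open>1 / y\<^sup>2\<close> of the densities; raised to the power \<open>q\<close> they
        produce the exponent \<open>2 * q\<close> of the hypergeometric weights.\<close>
      define Y where "Y = x\<^sup>2 * y\<^sup>2 * \<bar>D x y\<bar>"
      have pos: "0 < x" "0 < y" using x y assms by auto
      then have \<rho>\<sigma>: "0 < \<rho> x" "0 < \<sigma> y" using assms by (simp_all add: \<rho>_def \<sigma>_def)
      have "\<kappa> * (\<rho> x * \<sigma> y) * (x\<^sup>2 * y\<^sup>2) = 1"
        using assms pos by (simp add: \<kappa>_def \<rho>_def \<sigma>_def)
      then have "\<bar>k x * (l y * D x y)\<bar> = \<kappa> * (\<rho> x * \<sigma> y) * (x\<^sup>2 * y\<^sup>2) * \<bar>k x * (l y * D x y)\<bar>"
        by simp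
      also have "\<dots> = \<kappa> * (\<rho> x * \<sigma> y) * (X * Y)"
        by (simp add: X_def Y_def abs_mult ac_simps)
      also have "\<dots> \<le> \<kappa> * (\<rho> x * \<sigma> y) *
          (P powr (1 / p) * K powr (1 / q) * (X powr p / (p * P) + Y powr q / (q * K)))"
        using \<open>0 < \<kappa>\<close> \<rho>\<sigma> \<open>p > 1\<close> \<open>0 < P\<close> assms
        by (intro mult_left_mono Youngs_inequality_scaled) (auto simp: X_def Y_def)
      also have "\<dots> = \<Gamma> * (\<rho> x * \<sigma> y * X powr p / (p * P) + \<rho> x * \<sigma> y * Y powr q / (q * K))"
        by (simp add: \<Gamma>_def algebra_simps)
      also have "\<rho> x * \<sigma> y * X powr p = (\<rho> x * \<bar>k x\<bar> powr p) * (\<sigma> y * \<bar>l y\<bar> powr p)"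
        by (simp add: X_def powr_mult)
      also have "\<rho> x * \<sigma> y * Y powr q = \<rho> x * x powr (2 * q) * (\<sigma> y * y powr (2 * q)) * g x y"
      proof -
        have "z\<^sup>2 powr q = z powr (2 * q)" if "0 < z" for z :: real
          using that powr_powr[of z 2 q] by simp
        then show ?thesis
          using pos by (simp add: Y_def g_def powr_mult)
      qed
      also have "\<Gamma> * ((\<rho> x * \<bar>k x\<bar> powr p) * (\<sigma> y * \<bar>l y\<bar> powr p) / (p * P)
            + \<rho> x * x powr (2 * q) * (\<sigma> y * y powr (2 * q)) * g x y / (q * K))
          \<le> \<Gamma> * ((\<rho> x * \<bar>k x\<bar> powr p) * (\<sigma> y * \<bar>l y\<bar> powr p) / (p * P) + W x y / (q * K))"
      proof (intro mult_left_mono add_left_mono divide_right_mono)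
        let ?u = "harmonic_coord a b x" and ?v = "harmonic_coord c d y"
        have "\<rho> x * x powr (2 * q) * (\<sigma> y * y powr (2 * q)) * g x y
            \<le> \<rho> x * x powr (2 * q) * (\<sigma> y * y powr (2 * q)) * ((1 - ?u) * ((1 - ?v) * g a c + ?v * g a d)
              + ?u * ((1 - ?v) * g b c + ?v * g b d))"
          using harmonically_convex_on_coordinates_le[OF assms(7-10) conv x y] \<rho>\<sigma>
          by (intro mult_left_mono) (auto simp: g_def)
        also have "\<dots> = W x y"
          by (simp add: W_def r0_def r1_def s0_def s1_def algebra_simps)
        finally show "\<rho> x * x powr (2 * q) * (\<sigma> y * y powr (2 * q)) * g x y \<le> W x y" .
      qed (use \<open>0 \<le> \<Gamma>\<close> assms in auto)
      finally show ?thesis .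
    qed
    show "((\<lambda>y. \<Gamma> * ((\<rho> x * \<bar>k x\<bar> powr p) * (\<sigma> y * \<bar>l y\<bar> powr p) / (p * P) + W x y / (q * K)))
        has_integral \<Gamma> * ((\<rho> x * \<bar>k x\<bar> powr p) * (1 / (p + 1)) / (p * P)
          + (r0 x * (S0 * g a c + S1 * g a d) + r1 x * (S0 * g b c + S1 * g b d)) / (q * K))) {c..d}" for x
      unfolding W_def
      by (intro has_integral_mult_right has_integral_add has_integral_divide has_integral_mult_left l s0 s1)
    show "((\<lambda>x. \<Gamma> * ((\<rho> x * \<bar>k x\<bar> powr p) * (1 / (p + 1)) / (p * P)
          + (r0 x * (S0 * g a c + S1 * g a d) + r1 x * (S0 * g b c + S1 * g b d)) / (q * K)))
        has_integral \<Gamma> * (1 / (p + 1) * (1 / (p + 1)) / (p * P) + V / (q * K))) {a..b}"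
      unfolding V_def
      by (intro has_integral_mult_right has_integral_add has_integral_divide has_integral_mult_left k r0 r1)
  qed
  \<comment> \<open>The kernel term equals \<open>1 / p\<close> by the choice of \<open>P\<close>,
    and the majorant term is at most \<open>1 / q\<close> because \<open>V \<le> K\<close>.\<close>
  also have "\<dots> \<le> \<Gamma> * 1"
  proof (rule mult_left_mono)
    have "V \<le> a powr (2 * q) * A1 / 2 * (c powr (2 * q) * B1 / 2 * g a c + S1 * g a d)
        + R1 * (c powr (2 * q) * B1 / 2 * g b c + S1 * g b d)"
      unfolding V_def using R0 S0 nonneg g_nonneg
      by (intro add_mono mult_mono mult_right_mono mult_nonneg_nonneg add_nonneg_nonneg order_refl) auto
    also have "\<dots> \<le> K"
      using K(2) by (simp add: R1_def S1_def g_def algebra_simps add_divide_distrib)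
    finally have "V / (q * K) \<le> 1 / q"
      using K(1) \<open>q > 1\<close> by (simp add: divide_simps)
    moreover have "1 / (p + 1) * (1 / (p + 1)) / (p * P) = 1 / p"
      using \<open>p > 1\<close> by (simp add: P_def power2_eq_square)
    ultimately show "1 / (p + 1) * (1 / (p + 1)) / (p * P) + V / (q * K) \<le> 1"
      using \<open>1 / p + 1 / q = 1\<close> by linarith
  qed fact
  finally show ?thesis
    by (simp add: \<Gamma>_def \<kappa>_def P_def)
qed

section \<open>Sign and boundedness facts, and the final assembly\<close>

lemma hypergeometric_2F1_one_two_nonneg:
  assumes "z < 1"
  shows "0 \<le> hypergeometric_2F1 \<alpha> 1 2 z"
  unfolding hypergeometric_2F1_one_two
  by (intro Henstock_Kurzweil_Integration.integral_nonneg
      integrable_continuous_real continuous_on_powr_unit assms) auto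

text \<open>All weights of the bilinear majorant lie in [0, 1] and the corner values are
  nonnegative. This supplies the constant that dominates the mixed derivative.\<close>

lemma harmonically_convex_on_coordinates_bounded:
  assumes "0 < a" "a < b" "0 < c" "c < d"
    and "harmonically_convex_on_coordinates {a..b} {c..d} g" "\<And>x y. 0 \<le> g x y"
    and "x \<in> {a..b}" "y \<in> {c..d}"
  shows "g x y \<le> g a c + g a d + g b c + g b d"
proof -
  let ?u = "harmonic_coord a b x" and ?v = "harmonic_coord c d y"
  have u: "?u \<in> {0..1}" and v: "?v \<in> {0..1}"
    using assms by (auto intro!: harmonic_coord_mem simp del: atLeastAtMost_iff)
  have convex: "(1 - w) * s + w * t \<le> s + t" if "w \<in> {0..1}" "0 \<le> s" "0 \<le> t" for w s t :: real
    using that mult_right_mono[of "1 - w" 1 s] mult_right_mono[of w 1 t] by auto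
  have nonneg: "0 \<le> (1 - ?v) * s + ?v * t" if "0 \<le> s" "0 \<le> t" for s t
    using that v by auto
  have "g x y \<le> (1 - ?u) * ((1 - ?v) * g a c + ?v * g a d) + ?u * ((1 - ?v) * g b c + ?v * g b d)"
    using assms by (intro harmonically_convex_on_coordinates_le)
  also have "\<dots> \<le> ((1 - ?v) * g a c + ?v * g a d) + ((1 - ?v) * g b c + ?v * g b d)"
    using assms by (intro convex u nonneg)
  also have "\<dots> \<le> (g a c + g a d) + (g b c + g b d)"
    using assms by (intro add_mono convex v)
  finally show ?thesis by simp
qed

theorem theorem4:
  fixes a b c d p q :: real
    and f :: "real \<Rightarrow> real \<Rightarrow> real"
  defines "D \<equiv> mixed_partial {a..b} {c..d} f"
  defines "C1 \<equiv> hypergeometric_2F1 (2 * q) 1 2 (1 - a / b) * hypergeometric_2F1 (2 * q) 1 2 (1 - c / d)"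
    and "C2 \<equiv> hypergeometric_2F1 (2 * q) 1 2 (1 - a / b) * hypergeometric_2F1 (2 * q) 2 3 (1 - c / d)"
    and "C3 \<equiv> hypergeometric_2F1 (2 * q) 2 3 (1 - a / b) * hypergeometric_2F1 (2 * q) 1 2 (1 - c / d)"
    and "C4 \<equiv> hypergeometric_2F1 (2 * q) 2 3 (1 - a / b) * hypergeometric_2F1 (2 * q) 2 3 (1 - c / d)"
  assumes "0 < a" "a < b" "0 < c" "c < d"
    and "q > 1" "1 / p + 1 / q = 1"
    and "partially_differentiable_on {a..b} {c..d} f"
    and "(\<lambda>(x, y). D x y) absolutely_integrable_on {a..b} \<times> {c..d}"
    and "harmonically_convex_on_coordinates {a..b} {c..d} (\<lambda>x y. \<bar>D x y\<bar> powr q)"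
  shows
    "\<bar>(f a c + f a d + f b c + f b d) / 4
       + a * b * c * d / ((b - a) * (d - c)) *
           integral {a..b} (\<lambda>x. integral {c..d} (\<lambda>y. f x y / (x * y)\<^sup>2))
       - 1 / 2 *
          (a * b / (b - a) * integral {a..b} (\<lambda>x. f x c / x\<^sup>2)
           + a * b / (b - a) * integral {a..b} (\<lambda>x. f x d / x\<^sup>2)
           + c * d / (d - c) * integral {c..d} (\<lambda>y. f a y / y\<^sup>2)
           + c * d / (d - c) * integral {c..d} (\<lambda>y. f b y / y\<^sup>2))\<bar>
     \<le> a * c * (b - a) * (d - c) / (4 * b * d * (p + 1) powr (2 / p)) *
        ((C1 * \<bar>D a c\<bar> powr q + C2 * \<bar>D a d\<bar> powr q
          + C3 * \<bar>D b c\<bar> powr q + C4 * \<bar>D b d\<bar> powr q) / 4) powr (1 / q)"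
proof -
  define S where "S = partial_snd {c..d} f"
  define l where "l = (\<lambda>y. 2 * harmonic_coord c d y - 1)"
  have f_fst: "(\<lambda>u. f u y) differentiable (at x within {a..b})"
    and f_snd: "((\<lambda>v. f x v) has_real_derivative S x y) (at y within {c..d})"
    and S_fst: "((\<lambda>u. S u y) has_real_derivative D x y) (at x within {a..b})"
    if "x \<in> {a..b}" "y \<in> {c..d}" for x y
    using assms that
    by (auto simp: partially_differentiable_on_def mixed_partial_def partial_fst_def
        partial_snd_def[of _ _ x] S_def has_real_derivative_iff_has_vector_derivative
        vector_derivative_works)
  have l_bound: "\<bar>l y\<bar> \<le> 1" if "y \<in> {c..d}" for y
    using harmonic_coord_mem[of c d y] that assms by (auto simp: l_def)
  define \<Sigma> where "\<Sigma> = \<bar>D a c\<bar> powr q + \<bar>D a d\<bar> powr q + \<bar>D b c\<bar> powr q + \<bar>D b d\<bar> powr q"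
  have D_bound: "\<bar>l y * D x y\<bar> \<le> \<Sigma> powr (1 / q)" if x: "x \<in> {a..b}" and y: "y \<in> {c..d}" for x y
  proof -
    have "\<bar>D x y\<bar> = (\<bar>D x y\<bar> powr q) powr (1 / q)"
      using \<open>q > 1\<close> by (simp add: powr_powr)
    also have "\<dots> \<le> \<Sigma> powr (1 / q)"
      using harmonically_convex_on_coordinates_bounded[of a b c d "\<lambda>x y. \<bar>D x y\<bar> powr q" x y]
        assms x y unfolding \<Sigma>_def by (intro powr_mono2) auto
    finally show ?thesis
      using mult_mono[OF l_bound[OF y]] by (force simp: abs_mult)
  qed
  \<comment> \<open>\<open>H x\<close> is the trapezoid defect of \<open>f x\<close> in the second
    variable. Its \<open>x\<close>-derivative is the inner integral of \<open>l y * D x y\<close>,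
    so the trapezoid identity can be applied to \<open>H\<close> in the first variable.\<close>
  define H where "H = (\<lambda>x. integral {c..d} (\<lambda>y. l y * S x y))"
  define I where "I = (\<lambda>x. integral {c..d} (\<lambda>y. f x y / y\<^sup>2))"
  have H_int: "((\<lambda>y. l y * S x y) has_integral f x c + f x d - 2 * (c * d / (d - c) * I x)) {c..d}"
    if "x \<in> {a..b}" for x
    unfolding l_def I_def using assms that by (intro harmonic_trapezoid_has_integral f_snd)
  then have H_eq: "H x = f x c + f x d - 2 * (c * d / (d - c) * I x)" if "x \<in> {a..b}" for x
    unfolding H_def using that by (intro integral_unique)
  have D_int: "(\<lambda>y. l y * D x y) integrable_on {c..d}"
    and H_deriv: "(H has_real_derivative integral {c..d} (\<lambda>y. l y * D x y)) (at x within {a..b})"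
    if x: "x \<in> {a..b}" for x
  proof -
    have "((\<lambda>x. l y * S x y) has_real_derivative l y * D x y) (at x within {a..b})"
      if "x \<in> {a..b}" "y \<in> {c..d}" for x y
      using S_fst[OF that] by (rule DERIV_cmult)
    note deriv = has_real_derivative_integral_bounded[OF \<open>a < b\<close> x has_integral_integrable[OF H_int] this D_bound]
    show "(\<lambda>y. l y * D x y) integrable_on {c..d}"
      by (rule deriv)
    show "(H has_real_derivative integral {c..d} (\<lambda>y. l y * D x y)) (at x within {a..b})"
      unfolding H_def by (rule deriv)
  qed
  have cont: "continuous_on {a..b} (\<lambda>x. h x / x\<^sup>2)" if "continuous_on {a..b} h" for h :: "real \<Rightarrow> real"
    using that \<open>0 < a\<close> by (intro continuous_intros) auto
  have "continuous_on {a..b} (\<lambda>x. f x y)" if "y \<in> {c..d}" for y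
    using f_fst that by (intro differentiable_imp_continuous_on) (simp add: differentiable_on_def)
  then have f_int: "(\<lambda>x. f x y / x\<^sup>2) integrable_on {a..b}" if "y \<in> {c..d}" for y
    using that by (intro integrable_continuous_real cont)
  have H_int': "(\<lambda>x. H x / x\<^sup>2) integrable_on {a..b}"
    by (intro integrable_continuous_real cont DERIV_continuous_on[OF H_deriv])
  define E where "E = H a + H b - 2 * (a * b / (b - a) * integral {a..b} (\<lambda>x. H x / x\<^sup>2))"
  have E: "((\<lambda>x. (2 * harmonic_coord a b x - 1) * integral {c..d} (\<lambda>y. l y * D x y))
      has_integral E) {a..b}"
    unfolding E_def using assms by (intro harmonic_trapezoid_has_integral H_deriv)
  \<comment> \<open>Solving \<open>H_eq\<close> for \<open>I\<close> expresses the double integral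
    of \<open>f\<close> through integrals of three functions continuous in \<open>x\<close>.\<close>
  have I_int: "2 * (c * d / (d - c)) * integral {a..b} (\<lambda>x. I x / x\<^sup>2)
      = integral {a..b} (\<lambda>x. f x c / x\<^sup>2) + integral {a..b} (\<lambda>x. f x d / x\<^sup>2)
        - integral {a..b} (\<lambda>x. H x / x\<^sup>2)"
  proof -
    have "2 * (c * d / (d - c)) * integral {a..b} (\<lambda>x. I x / x\<^sup>2)
        = integral {a..b} (\<lambda>x. 2 * (c * d / (d - c)) * (I x / x\<^sup>2))"
      by (rule integral_mult_right[symmetric])
    also have "\<dots> = integral {a..b} (\<lambda>x. f x c / x\<^sup>2 + f x d / x\<^sup>2 - H x / x\<^sup>2)"
      using H_eq by (intro integral_cong) (simp add: diff_divide_distrib add_divide_distrib)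
    also have "\<dots> = integral {a..b} (\<lambda>x. f x c / x\<^sup>2) + integral {a..b} (\<lambda>x. f x d / x\<^sup>2)
        - integral {a..b} (\<lambda>x. H x / x\<^sup>2)"
      using f_int[of c] f_int[of d] H_int' \<open>c < d\<close>
      by (simp add: Henstock_Kurzweil_Integration.integral_diff
          Henstock_Kurzweil_Integration.integral_add integrable_add)
    finally show ?thesis .
  qed
  have inner: "integral {c..d} (\<lambda>y. f x y / (x * y)\<^sup>2) = I x / x\<^sup>2" for x
  proof -
    have "(\<lambda>y. f x y / (x * y)\<^sup>2) = (\<lambda>y. f x y / y\<^sup>2 / x\<^sup>2)"
      by (simp add: power_mult_distrib mult.commute)
    then show ?thesis
      by (simp only: integral_divide I_def)
  qed
  let ?L = "(f a c + f a d + f b c + f b d) / 4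
       + a * b * c * d / ((b - a) * (d - c)) *
           integral {a..b} (\<lambda>x. integral {c..d} (\<lambda>y. f x y / (x * y)\<^sup>2))
       - 1 / 2 *
          (a * b / (b - a) * integral {a..b} (\<lambda>x. f x c / x\<^sup>2)
           + a * b / (b - a) * integral {a..b} (\<lambda>x. f x d / x\<^sup>2)
           + c * d / (d - c) * integral {c..d} (\<lambda>y. f a y / y\<^sup>2)
           + c * d / (d - c) * integral {c..d} (\<lambda>y. f b y / y\<^sup>2))"
  \<comment> \<open>Each trapezoid identity gives a sum of two end values minus twice a mean, that
    is, twice the averaged defect; two applications account for the factor 4.\<close>
  have L_eq: "?L = E / 4"
  proof -
    define m n where "m = a * b / (b - a)" and "n = c * d / (d - c)"
    have coeff: "a * b * c * d / ((b - a) * (d - c)) = m * n"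
      by (simp add: m_def n_def)
    have edge: "integral {c..d} (\<lambda>y. f x y / y\<^sup>2) = I x" for x
      by (simp add: I_def)
    have H_mean: "integral {a..b} (\<lambda>x. H x / x\<^sup>2) = integral {a..b} (\<lambda>x. f x c / x\<^sup>2)
        + integral {a..b} (\<lambda>x. f x d / x\<^sup>2) - 2 * n * integral {a..b} (\<lambda>x. I x / x\<^sup>2)"
      using I_int by (simp add: n_def)
    have H_ends: "H a = f a c + f a d - 2 * (n * I a)" "H b = f b c + f b d - 2 * (n * I b)"
      using H_eq \<open>a < b\<close> by (simp_all add: n_def)
    show ?thesis
      unfolding inner edge coeff E_def m_def[symmetric] n_def[symmetric] H_mean H_ends
      by (simp add: field_simps)
  qed
  define Q where "Q = (C1 * \<bar>D a c\<bar> powr q + C2 * \<bar>D a d\<bar> powr q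
          + C3 * \<bar>D b c\<bar> powr q + C4 * \<bar>D b d\<bar> powr q) / 4"
  define K where "K = a powr (2 * q) * c powr (2 * q) * Q"
  define \<gamma> where "\<gamma> = (b - a) * (d - c) / (a * b * c * d)"
  let ?B = "\<lambda>K. \<gamma> * (((1 / (p + 1))\<^sup>2) powr (1 / p) * K powr (1 / q))"
  have F_nonneg: "0 \<le> hypergeometric_2F1 (2 * q) 1 2 (1 - s / t)"
      "0 \<le> hypergeometric_2F1 (2 * q) 2 3 (1 - s / t)" if "0 < s" "0 < t" for s t
    using that by (auto intro: hypergeometric_2F1_one_two_nonneg hypergeometric_2F1_two_three_nonneg)
  have "0 \<le> Q"
    unfolding Q_def C1_def C2_def C3_def C4_def using assms
    by (intro divide_nonneg_nonneg add_nonneg_nonneg mult_nonneg_nonneg F_nonneg) auto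
  then have "0 \<le> K" by (simp add: K_def)
  \<comment> \<open>The scaled Young inequality needs a positive scale, but \<open>K\<close> may vanish; hence the limit
    \<open>K' \<rightarrow> K\<close>.\<close>
  have bound: "\<bar>E\<bar> \<le> ?B K'" if "K < K'" for K'
    unfolding \<gamma>_def
  proof (rule harmonic_kernel_estimate[OF \<open>0 < a\<close> \<open>a < b\<close> \<open>0 < c\<close> \<open>c < d\<close> \<open>q > 1\<close> \<open>1 / p + 1 / q = 1\<close>])
    show "harmonically_convex_on_coordinates {a..b} {c..d} (\<lambda>x y. \<bar>D x y\<bar> powr q)"
      by fact
    show "(\<lambda>y. (2 * harmonic_coord c d y - 1) * D x y) integrable_on {c..d}" if "x \<in> {a..b}" for x
      using D_int[OF that] by (simp only: l_def)
    show "((\<lambda>x. (2 * harmonic_coord a b x - 1) * integral {c..d}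
        (\<lambda>y. (2 * harmonic_coord c d y - 1) * D x y)) has_integral E) {a..b}"
      using E by (simp only: l_def)
    show "0 < K'"
      using that \<open>0 \<le> K\<close> by linarith
  qed (use less_imp_le[OF that] in \<open>simp only: K_def Q_def C1_def C2_def C3_def C4_def\<close>)
  have "\<bar>E\<bar> \<le> ?B K"
  proof (rule tendsto_lowerbound)
    show "(?B \<longlongrightarrow> ?B K) (at_right K)"
      using \<open>0 \<le> K\<close> \<open>q > 1\<close>
      by (intro tendsto_intros tendsto_powr') (auto simp: eventually_at_filter)
    show "\<forall>\<^sub>F K' in at_right K. \<bar>E\<bar> \<le> ?B K'"
      using bound by (auto simp: eventually_at_filter)
  qed simp
  \<comment> \<open>\<open>K powr (1 / q)\<close> releases \<open>a\<^sup>2 * c\<^sup>2\<close>,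
    which against the denominator \<open>a * b * c * d\<close> of \<gamma> leaves the ratio
    \<open>a * c / (b * d)\<close>.\<close>
  also have "?B K = 4 * (a * c * (b - a) * (d - c) / (4 * b * d * (p + 1) powr (2 / p)) * Q powr (1 / q))"
  proof -
    have "1 / q < 1" "0 < 1 / q"
      using \<open>q > 1\<close> by auto
    then have "0 < 1 / p"
      using \<open>1 / p + 1 / q = 1\<close> by linarith
    then have "0 < p" by simp
    have "((1 / (p + 1))\<^sup>2) powr (1 / p) = 1 / (p + 1) powr (2 / p)"
      using \<open>0 < p\<close> powr_powr[of "p + 1" 2 "1 / p"] by (simp add: power_divide powr_divide)
    moreover have "K powr (1 / q) = a\<^sup>2 * c\<^sup>2 * Q powr (1 / q)"
      using \<open>0 \<le> Q\<close> assms by (simp add: K_def powr_mult powr_powr)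
    ultimately show ?thesis
      using \<open>0 < a\<close> \<open>0 < c\<close> by (simp add: \<gamma>_def power2_eq_square) (simp only: mult_ac)
  qed
  finally have "\<bar>E / 4\<bar> \<le> a * c * (b - a) * (d - c) / (4 * b * d * (p + 1) powr (2 / p)) * Q powr (1 / q)"
    by simp
  then show ?thesis
    unfolding L_eq Q_def .
qed

end
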